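(* Let $$\Delta=\left\{\left(\frac{r}{q},\frac{q-1}{q}\right)\ \middle|\ r,q\in\mathbb{Z},\ 0<r<q,\ \gcd(r,q)=1\right\}\subset\mathbb{R}^2 .$$ Then $\Delta$ is self-similar with respect to the two projective transformations $$T_1(x,y)=\left(\frac{x}{1+x},\frac{x+y}{1+x}\right),\qquad T_2(x,y)=\left(\frac{1}{2-x},\frac{1+y-x}{2-x}\right),$$ in the sense that $$\Delta=T_1(\Delta)\sqcup T_2(\Delta)\sqcup\left\{\left(\tfrac12,\tfrac12\right)\right\},$$ where $\sqcup$ denotes disjoint union (the three sets on the right are pairwise disjoint and their union is $\Delta$).
   Context: The set $\Delta$ is the projection to the $xy$-plane of one of the three families of vertices of the graph of the function $R_{ab}$ (the maximal translation number of a product of two lifts of circle homeomorphisms with prescribed translation numbers), namely the family $\left(\frac{r}{q},1-\frac1q,1+\frac{r}{q}\right)$ with coprime $0<r<q$. The claim only uses the explicit description of $\Delta$. Every point of $\Delta$ has first coordinate in $(0,1)$, so $T_1$ and $T_2$ are defined on $\Delta$. *)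

theory Defs
  imports Complex_Main
begin

definition Delta :: "(real \<times> real) set" where
  "Delta = {(of_int r / of_int q, of_int (q - 1) / of_int q) | r q :: int.
              0 < r \<and> r < q \<and> gcd r q = 1}"

(* T1 and T2 are genuine only off the lines x = -1 and x = 2 respectively, where HOL's
   division by zero yields a junk value; Delta lies in the strip 0 < x < 1. *)

definition T1 :: "real \<times> real \<Rightarrow> real \<times> real" where
  "T1 = (\<lambda>(x, y). (x / (1 + x), (x + y) / (1 + x)))"

definition T2 :: "real \<times> real \<Rightarrow> real \<times> real" where
  "T2 = (\<lambda>(x, y). (1 / (2 - x), (1 + y - x) / (2 - x)))"

end

theory Submission
  imports Defs
begin

text \<open>On reduced fractions \<open>T1\<close> acts as \<open>r/q \<mapsto> r/(q+r)\<close> and \<open>T2\<close> as \<open>r/q \<mapsto> q/(2q-r)\<close>. Both preserve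
  coprimality and are inverted by the subtractive Euclidean steps \<open>(r, q) \<mapsto> (r, q-r)\<close> and
  \<open>(r, q) \<mapsto> (2r-q, r)\<close>, which apply exactly when the fraction lies below, respectively above, \<open>1/2\<close>.\<close>

text \<open>Points are indexed by integer pairs so that \<open>T1\<close> and \<open>T2\<close>
  become linear maps of \<open>(r, q)\<close>. Coprimality stays outside, to be tracked
  separately.\<close>

definition Delta_point :: "int \<Rightarrow> int \<Rightarrow> real \<times> real" where
  "Delta_point r q = (of_int r / of_int q, of_int (q - 1) / of_int q)"

lemma Delta_pointI:
  assumes "0 < r" "r < q" "coprime r q"
  shows "Delta_point r q \<in> Delta"
  unfolding Delta_def Delta_point_def mem_Collect_eq
  by (rule exI[of _ r], rule exI[of _ q]) (use assms in simp)

lemma Delta_pointE: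
  assumes "p \<in> Delta"
  obtains r q where "p = Delta_point r q" "0 < r" "r < q" "coprime r q"
proof -
  obtain r q :: int where "p = (of_int r / of_int q, of_int (q - 1) / of_int q)"
    and "0 < r \<and> r < q \<and> gcd r q = 1"
    using assms unfolding Delta_def mem_Collect_eq by (elim exE conjE) simp
  then show thesis using that[of r q] by (simp add: Delta_point_def coprime_iff_gcd_eq_1)
qed

text \<open>Clearing the factor \<open>q\<close> turns \<open>x + y\<close> into
  \<open>r + q - 1\<close>, the new denominator minus one, so the shape of the second coordinate
  survives.\<close>

lemma T1_Delta_point:
  assumes "0 < r" "r < q"
  shows "T1 (Delta_point r q) = Delta_point r (q + r)"
  using assms by (simp add: T1_def Delta_point_def divide_simps) (simp add: algebra_simps)?

lemma T2_Delta_point: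
  assumes "0 < r" "r < q"
  shows "T2 (Delta_point r q) = Delta_point q (2 * q - r)"
proof -
  have "real_of_int r < of_int q" "0 < real_of_int r" using assms by simp_all
  then have "real_of_int q \<noteq> 0" "2 * real_of_int q - of_int r \<noteq> 0" by linarith+
  then show ?thesis
    by (simp add: T2_def Delta_point_def divide_simps) (simp add: algebra_simps)?
qed

text \<open>Serves both directions for \<open>T2\<close>: as stated for its inverse step, and with
  \<open>r\<close> and \<open>q\<close> interchanged for \<open>T2\<close> itself.\<close>

lemma coprime_diff_double_left_iff:
  fixes r q :: int
  shows "coprime (2 * r - q) r \<longleftrightarrow> coprime r q"
proof -
  have "gcd (2 * r - q) r = gcd ((r - q) + r) r" by (simp add: algebra_simps)
  also have "\<dots> = gcd q r" by (simp only: gcd_add1 gcd_diff2)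
  finally show ?thesis by (simp add: coprime_iff_gcd_eq_1 gcd.commute)
qed

text \<open>Describing the image as a slice of \<open>Delta\<close> by first coordinate reduces the
  decomposition to comparing that coordinate with 1/2.\<close>

lemma T1_Delta: "T1 ` Delta = {p \<in> Delta. fst p < 1/2}"
proof (intro equalityI subsetI)
  fix p assume "p \<in> T1 ` Delta"
  then obtain r q where "p = T1 (Delta_point r q)" and rq: "0 < r" "r < q" "coprime r q"
    by (auto elim: Delta_pointE)
  then have p: "p = Delta_point r (q + r)" by (simp add: T1_Delta_point)
  have "coprime r (q + r)" using rq by (simp add: coprime_iff_gcd_eq_1 gcd.commute[of r])
  moreover have "fst p < 1/2" using rq by (simp add: p Delta_point_def divide_simps)
  ultimately show "p \<in> {p \<in> Delta. fst p < 1/2}" using rq by (simp add: p Delta_pointI)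
next
  fix p assume "p \<in> {p \<in> Delta. fst p < 1/2}"
  then obtain r q where p: "p = Delta_point r q" and rq: "0 < r" "r < q" "coprime r q"
    and "fst p < 1/2" by (auto elim: Delta_pointE)
  \<comment> \<open>This is the bound that makes \<open>(r, q - r)\<close> an admissible index for
    the preimage.\<close>
  then have "r < q - r" by (simp add: Delta_point_def divide_simps split: if_splits)
  moreover have "coprime r (q - r)"
    using rq by (metis coprime_iff_gcd_eq_1 gcd.commute gcd_diff1)
  ultimately have "Delta_point r (q - r) \<in> Delta" "p = T1 (Delta_point r (q - r))"
    using rq by (simp_all add: p T1_Delta_point Delta_pointI)
  then show "p \<in> T1 ` Delta" by blast
qed

lemma T2_Delta: "T2 ` Delta = {p \<in> Delta. 1/2 < fst p}"
proof (intro equalityI subsetI)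
  fix p assume "p \<in> T2 ` Delta"
  then obtain r q where "p = T2 (Delta_point r q)" and rq: "0 < r" "r < q" "coprime r q"
    by (auto elim: Delta_pointE)
  then have p: "p = Delta_point q (2 * q - r)" by (simp add: T2_Delta_point)
  have "coprime q (2 * q - r)"
    using rq coprime_diff_double_left_iff[of q r] by (simp add: coprime_commute)
  \<comment> \<open>The inequality \<open>q / (2 * q - r) > 1/2\<close> amounts to
    \<open>0 < r\<close>.\<close>
  moreover have "1/2 < fst p" using rq by (simp add: p Delta_point_def divide_simps)
  ultimately show "p \<in> {p \<in> Delta. 1/2 < fst p}" using rq by (simp add: p Delta_pointI)
next
  fix p assume "p \<in> {p \<in> Delta. 1/2 < fst p}"
  then obtain r q where p: "p = Delta_point r q" and rq: "0 < r" "r < q" "coprime r q"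
    and "1/2 < fst p" by (auto elim: Delta_pointE)
  \<comment> \<open>The other bound on the preimage index, \<open>2 * r - q < r\<close>, is just
    \<open>r < q\<close>.\<close>
  then have "0 < 2 * r - q" by (simp add: Delta_point_def divide_simps split: if_splits)
  moreover have "coprime (2 * r - q) r"
    using rq by (simp add: coprime_diff_double_left_iff)
  ultimately have "Delta_point (2 * r - q) r \<in> Delta" "p = T2 (Delta_point (2 * r - q) r)"
    using rq by (simp_all add: p T2_Delta_point Delta_pointI)
  then show "p \<in> T2 ` Delta" by blast
qed

lemma Delta_fst_half: "{p \<in> Delta. fst p = 1/2} = {(1/2, 1/2)}"
proof (intro equalityI subsetI)
  fix p assume "p \<in> {p \<in> Delta. fst p = 1/2}"
  then obtain r q where p: "p = Delta_point r q" and rq: "0 < r" "r < q" "coprime r q"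
    and "fst p = 1/2" by (auto elim: Delta_pointE)
  then have "q = 2 * r" by (simp add: Delta_point_def divide_simps split: if_splits)
  \<comment> \<open>Here \<open>r\<close> divides \<open>q\<close>, so coprimality forces
    \<open>r = 1\<close>.\<close>
  with rq have "r = 1" "q = 2" by simp_all
  then show "p \<in> {(1/2, 1/2)}" by (simp add: p Delta_point_def)
next
  fix p :: "real \<times> real" assume "p \<in> {(1/2, 1/2)}"
  then have "p = Delta_point 1 2" "fst p = 1/2" by (simp_all add: Delta_point_def)
  then show "p \<in> {p \<in> Delta. fst p = 1/2}" by (simp add: Delta_pointI)
qed

theorem theorem4:
  shows "Delta = T1 ` Delta \<union> T2 ` Delta \<union> {(1/2, 1/2)}
    \<and> T1 ` Delta \<inter> T2 ` Delta = {}
    \<and> T1 ` Delta \<inter> {(1/2, 1/2)} = {}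
    \<and> T2 ` Delta \<inter> {(1/2, 1/2)} = {}"
  \<comment> \<open>Once the singleton is also read as a slice, only trichotomy of
    \<open>fst p\<close> against 1/2 remains.\<close>
  unfolding T1_Delta T2_Delta Delta_fst_half[symmetric] by auto

end
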